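(* Let $\mathcal{A}\subseteq\mathcal{B}(\mathcal{H}_1)$ and $\mathcal{B}\subseteq\mathcal{B}(\mathcal{H}_2)$ be reflexive algebras, $\mathcal{L}_1=\operatorname{Lat}\mathcal{A}$ and $\mathcal{L}_2=\operatorname{Lat}\mathcal{B}$. For $\varphi\in\mathcal{M}(\mathcal{L}_1,\mathcal{L}_2)$ put $$\mathcal{U}_\varphi=\{T\in\mathcal{B}(\mathcal{H}_1,\mathcal{H}_2):TL=\varphi(L)T\text{ for all }L\in\mathcal{L}_1\}.$$ Then the set $SN(\mathcal{B},\mathcal{A})$ of semi-normalizers of $\mathcal{B}$ into $\mathcal{A}$ is a union of reflexive normalizing subspaces. More precisely, $$SN(\mathcal{B},\mathcal{A})=\bigcup\{\mathcal{U}_\varphi:\varphi\in\mathcal{M}(\mathcal{L}_1,\mathcal{L}_2)\},$$ where each $\mathcal{U}_\varphi$ is a reflexive normalizing subspace.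
   Context: All Hilbert spaces are complex and separable. $\mathcal{P}_i$ is the lattice of all projections on $\mathcal{H}_i$, $P^\perp=I-P$. Reflexive algebras are unital: $\mathcal{A}$ is reflexive if $\mathcal{A}=\operatorname{Alg}\operatorname{Lat}\mathcal{A}$, where $\operatorname{Lat}\mathcal{A}=\{L:L^\perp AL=0\ \forall A\in\mathcal{A}\}$ and $\operatorname{Alg}\mathcal{L}=\{A:L^\perp AL=0\ \forall L\in\mathcal{L}\}$. $SN(\mathcal{B},\mathcal{A})=\{T\in\mathcal{B}(\mathcal{H}_1,\mathcal{H}_2):T^*\mathcal{B}T\subseteq\mathcal{A}\}$. $\mathcal{M}(\mathcal{P}_1,\mathcal{P}_2)$ is the set of maps $\varphi:\mathcal{P}_1\to\mathcal{P}_2$ with $\varphi(0)=0$ preserving arbitrary suprema; $\mathcal{S}_{2\varphi}=\varphi(\mathcal{P}_1)$, $\mathcal{S}_{1\varphi}=\{\bigvee\{P\in\mathcal{P}_1:\varphi(P)\le Q\}:Q\in\mathcal{P}_2\}$, and $\mathcal{M}(\mathcal{L}_1,\mathcal{L}_2)=\{\varphi\in\mathcal{M}(\mathcal{P}_1,\mathcal{P}_2):\mathcal{S}_{i\varphi}\subseteq\mathcal{L}_i,\ i=1,2\}$. A linear subspace $\mathcal{U}\subseteq\mathcal{B}(\mathcal{H}_1,\mathcal{H}_2)$ is normalizing if $AB^*C\in\mathcal{U}$ for all $A,B,C\in\mathcal{U}$; it is reflexive if every $T$ with $Tx\in\overline{\mathcal{U}x}$ for all $x\in\mathcal{H}_1$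 belongs to $\mathcal{U}$. *)

theory Defs
  imports "HOL-Analysis.Analysis"
begin

section \<open>Separable complex Hilbert spaces\<close>

text \<open>The inner product is linear in the first argument.  Real scalar multiplication,
  norm, metric and completeness come from \<^class>\<open>banach\<close> and are tied to the complex
  structure by the axioms \<open>scaleC_of_real\<close> and \<open>cinner_self\<close>.\<close>

class complex_hilbert = banach +
  fixes scaleC :: "complex \<Rightarrow> 'a \<Rightarrow> 'a" (infixr "*\<^sub>C" 75)
    and cinner :: "'a \<Rightarrow> 'a \<Rightarrow> complex"
  assumes scaleC_add_right: "a *\<^sub>C (x + y) = a *\<^sub>C x + a *\<^sub>C y"
    and scaleC_add_left: "(a + b) *\<^sub>C x = a *\<^sub>C x + b *\<^sub>C x"
    and scaleC_scaleC: "a *\<^sub>C b *\<^sub>C x = (a * b) *\<^sub>C x"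
    and scaleC_of_real: "complex_of_real r *\<^sub>C x = r *\<^sub>R x"
    and cinner_add_left: "cinner (x + y) z = cinner x z + cinner y z"
    and cinner_scaleC_left: "cinner (a *\<^sub>C x) y = a * cinner x y"
    and cinner_commute: "cinner x y = cnj (cinner y x)"
    and cinner_self: "cinner x x = complex_of_real ((norm x)\<^sup>2)"

class separable_hilbert = complex_hilbert +
  assumes separable: "\<exists>D. countable D \<and> (\<forall>x. \<forall>e>0. \<exists>d\<in>D. dist d x < e)"


section \<open>Bounded operators\<close>

definition bounded_clinear :: "('a::complex_hilbert \<Rightarrow> 'b::complex_hilbert) \<Rightarrow> bool" where
  "bounded_clinear T \<longleftrightarrow> bounded_linear T \<and> (\<forall>c x. T (c *\<^sub>C x) = c *\<^sub>C T x)"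

text \<open>Only meaningful for bounded operators, where such an \<open>S\<close> exists and is unique.\<close>

definition cadjoint :: "('a::complex_hilbert \<Rightarrow> 'b::complex_hilbert) \<Rightarrow> 'b \<Rightarrow> 'a" where
  "cadjoint T = (THE S. \<forall>x y. cinner (T x) y = cinner x (S y))"


section \<open>The lattice of projections\<close>

definition Projs :: "('a::complex_hilbert \<Rightarrow> 'a) set" where
  "Projs = {P. bounded_clinear P \<and> P \<circ> P = P \<and> cadjoint P = P}"

definition perp :: "('a::complex_hilbert \<Rightarrow> 'a) \<Rightarrow> 'a \<Rightarrow> 'a" where
  "perp P = (\<lambda>x. x - P x)"

definition proj_le :: "('a::complex_hilbert \<Rightarrow> 'a) \<Rightarrow> ('a \<Rightarrow> 'a) \<Rightarrow> bool" where
  "proj_le P Q \<longleftrightarrow> range P \<subseteq> range Q"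

definition is_proj_Sup :: "('a::complex_hilbert \<Rightarrow> 'a) set \<Rightarrow> ('a \<Rightarrow> 'a) \<Rightarrow> bool" where
  "is_proj_Sup F S \<longleftrightarrow> S \<in> Projs \<and> (\<forall>P\<in>F. proj_le P S) \<and>
     (\<forall>R\<in>Projs. (\<forall>P\<in>F. proj_le P R) \<longrightarrow> proj_le S R)"

definition proj_Sup :: "('a::complex_hilbert \<Rightarrow> 'a) set \<Rightarrow> 'a \<Rightarrow> 'a" where
  "proj_Sup F = (THE S. is_proj_Sup F S)"


section \<open>Reflexive algebras and semi-normalizers\<close>

definition Lat :: "('a::complex_hilbert \<Rightarrow> 'a) set \<Rightarrow> ('a \<Rightarrow> 'a) set" where
  "Lat \<A> = {L \<in> Projs. \<forall>A\<in>\<A>. perp L \<circ> A \<circ> L = (\<lambda>x. 0)}"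

definition Alg :: "('a::complex_hilbert \<Rightarrow> 'a) set \<Rightarrow> ('a \<Rightarrow> 'a) set" where
  "Alg \<L> = {A. bounded_clinear A \<and> (\<forall>L\<in>\<L>. perp L \<circ> A \<circ> L = (\<lambda>x. 0))}"

text \<open>No separate algebra hypothesis is needed: \<open>Alg\<close> of a set of projections is always
  a unital algebra of bounded operators.\<close>

definition reflexive_algebra :: "('a::complex_hilbert \<Rightarrow> 'a) set \<Rightarrow> bool" where
  "reflexive_algebra \<A> \<longleftrightarrow> \<A> = Alg (Lat \<A>)"

definition SN ::
  "('b::complex_hilbert \<Rightarrow> 'b) set \<Rightarrow> ('a::complex_hilbert \<Rightarrow> 'a) set \<Rightarrow> ('a \<Rightarrow> 'b) set" where
  "SN \<B> \<A> = {T. bounded_clinear T \<and> (\<forall>B\<in>\<B>. cadjoint T \<circ> B \<circ> T \<in> \<A>)}"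


section \<open>Sup-preserving maps between projection lattices\<close>

text \<open>The extensional function space makes a map on the projections a unique HOL function.\<close>

definition sup_maps :: "(('a::complex_hilbert \<Rightarrow> 'a) \<Rightarrow> ('b::complex_hilbert \<Rightarrow> 'b)) set" where
  "sup_maps = {\<phi> \<in> Projs \<rightarrow>\<^sub>E Projs. \<phi> (\<lambda>x. 0) = (\<lambda>x. 0) \<and>
     (\<forall>F\<subseteq>Projs. \<phi> (proj_Sup F) = proj_Sup (\<phi> ` F))}"

definition S1 ::
  "(('a::complex_hilbert \<Rightarrow> 'a) \<Rightarrow> ('b::complex_hilbert \<Rightarrow> 'b)) \<Rightarrow> ('a \<Rightarrow> 'a) set" where
  "S1 \<phi> = (\<lambda>Q. proj_Sup {P \<in> Projs. proj_le (\<phi> P) Q}) ` Projs"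

definition S2 ::
  "(('a::complex_hilbert \<Rightarrow> 'a) \<Rightarrow> ('b::complex_hilbert \<Rightarrow> 'b)) \<Rightarrow> ('b \<Rightarrow> 'b) set" where
  "S2 \<phi> = \<phi> ` Projs"

definition sup_maps_between ::
  "('a::complex_hilbert \<Rightarrow> 'a) set \<Rightarrow> ('b::complex_hilbert \<Rightarrow> 'b) set
    \<Rightarrow> (('a \<Rightarrow> 'a) \<Rightarrow> ('b \<Rightarrow> 'b)) set" where
  "sup_maps_between \<L>1 \<L>2 = {\<phi> \<in> sup_maps. S1 \<phi> \<subseteq> \<L>1 \<and> S2 \<phi> \<subseteq> \<L>2}"


section \<open>Spaces of operators\<close>

definition operator_subspace :: "('a::complex_hilbert \<Rightarrow> 'b::complex_hilbert) set \<Rightarrow> bool" where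
  "operator_subspace U \<longleftrightarrow> (\<forall>T\<in>U. bounded_clinear T) \<and> (\<lambda>x. 0) \<in> U \<and>
     (\<forall>S\<in>U. \<forall>T\<in>U. (\<lambda>x. S x + T x) \<in> U) \<and> (\<forall>c. \<forall>T\<in>U. (\<lambda>x. c *\<^sub>C T x) \<in> U)"

definition normalizing_subspace :: "('a::complex_hilbert \<Rightarrow> 'b::complex_hilbert) set \<Rightarrow> bool" where
  "normalizing_subspace U \<longleftrightarrow> operator_subspace U \<and>
     (\<forall>A\<in>U. \<forall>B\<in>U. \<forall>C\<in>U. A \<circ> cadjoint B \<circ> C \<in> U)"

definition reflexive_subspace :: "('a::complex_hilbert \<Rightarrow> 'b::complex_hilbert) set \<Rightarrow> bool" where
  "reflexive_subspace U \<longleftrightarrow> operator_subspace U \<and>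
     (\<forall>T. bounded_clinear T \<longrightarrow> (\<forall>x. T x \<in> closure {S x |S. S \<in> U}) \<longrightarrow> T \<in> U)"

definition intertwiners ::
  "('a::complex_hilbert \<Rightarrow> 'a) set \<Rightarrow> (('a \<Rightarrow> 'a) \<Rightarrow> ('b::complex_hilbert \<Rightarrow> 'b))
    \<Rightarrow> ('a \<Rightarrow> 'b) set" where
  "intertwiners \<L>1 \<phi> = {T. bounded_clinear T \<and> (\<forall>L\<in>\<L>1. T \<circ> L = \<phi> L \<circ> T)}"

end

theory Submission
  imports Defs
begin

text \<open>Write \<open>[X]\<close> for the closed linear span of \<open>X\<close>, and let \<open>T\<close> be a semi-normalizer.  A map
  \<open>\<phi>\<close> is wanted with \<open>T L = \<phi>(L) T\<close> for every \<open>L\<close> in \<open>Lat \<A>\<close>; in other words, \<open>\<phi>(L)\<close> has to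
  contain the range of \<open>T L\<close> and to be orthogonal to the range of \<open>T L\<^sup>\<bottom>\<close>.  The map that works sends
  \<open>P\<close> to the projection onto \<open>[\<B> T \<A> P H\<^sub>1]\<close>.  For an invariant \<open>L\<close> this space is \<open>[\<B> T L H\<^sub>1]\<close>; it
  contains the range of \<open>T L\<close> because \<open>\<B>\<close> is unital, and \<open>T\<^sup>* \<B> T \<subseteq> \<A>\<close> says exactly that it is
  orthogonal to the range of \<open>T L\<^sup>\<bottom>\<close>.  Using \<open>\<B> T \<A>\<close> rather than \<open>\<B> T\<close> is what puts both ranges
  \<open>S1 \<phi>\<close> and \<open>S2 \<phi>\<close> into the prescribed lattices: \<open>[\<B> T \<A> P H\<^sub>1]\<close> is \<open>\<B>\<close>-invariant, and the
  projection of \<open>S1 \<phi>\<close> that belongs to \<open>Q\<close> has range \<open>{x. \<B> T \<A> x \<subseteq> Q H\<^sub>2}\<close>, which is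
  \<open>\<A>\<close>-invariant.

  The map preserves suprema because it is the lower half of a Galois connection: for a family \<open>U\<close>
  of operators and a closed subspace \<open>N\<close>, the inclusion \<open>[U M] \<subseteq> N\<close> holds exactly if
  \<open>M \<subseteq> {x. U x \<subseteq> N}\<close>.  The lemmas \<open>sup_map_in_sup_maps\<close> and
  \<open>proj_Sup_sup_map_le\<close> state this for arbitrary \<open>U\<close>.

  Conversely, \<open>T L = \<phi>(L) T\<close> and its adjoint \<open>L T\<^sup>* = T\<^sup>* \<phi>(L)\<close> give
  \<open>L\<^sup>\<bottom> T\<^sup>* B T L = T\<^sup>* \<phi>(L)\<^sup>\<bottom> B \<phi>(L) T\<close>, which vanishes for \<open>B\<close> in \<open>\<B>\<close>; hence \<open>T\<^sup>* B T\<close> lies in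
  \<open>Alg (Lat \<A>) = \<A>\<close>.  The same two commutation relations show that the intertwiners of \<open>\<phi>\<close> are
  closed under \<open>A B\<^sup>* C\<close>.  They form a reflexive space because intertwining is a condition on single
  vectors (\<open>intertwines_iff\<close>): \<open>T\<close> maps the range of \<open>L\<close> into that of \<open>\<phi>(L)\<close>, and the kernel of \<open>L\<close> into the kernel of
  \<open>\<phi>(L)\<close>, both of which are closed.

  All this rests on the projection theorem and on the existence of adjoints, which are derived
  from the axioms of a complex Hilbert space.\<close>

section \<open>Inner products\<close>

lemma cinner_add_right: "cinner x (y + z) = cinner x y + cinner x z"
  by (metis cinner_add_left cinner_commute complex_cnj_add)

lemma cinner_scaleC_right: "cinner x (c *\<^sub>C y) = cnj c * cinner x y"
  by (metis cinner_commute cinner_scaleC_left complex_cnj_mult)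

lemma scaleC_minus1: "(-1) *\<^sub>C x = - (x::'a::complex_hilbert)"
  using scaleC_of_real[of "-1" x] by simp

lemma scaleC_diff_right: "c *\<^sub>C (x - y) = c *\<^sub>C x - c *\<^sub>C (y::'a::complex_hilbert)"
  by (metis add_diff_cancel diff_add_cancel scaleC_add_right)

lemma scaleC_zero_right: "c *\<^sub>C 0 = (0::'a::complex_hilbert)"
  using scaleC_diff_right[of c 0 0] by simp

lemma cinner_diff_left: "cinner (x - y) z = cinner x z - cinner y z"
  by (metis add_diff_cancel cinner_add_left diff_add_cancel)

lemma cinner_diff_right: "cinner x (y - z) = cinner x y - cinner x z"
  by (metis add_diff_cancel cinner_add_right diff_add_cancel)

lemma cinner_zero_left [simp]: "cinner 0 x = 0"
  using cinner_diff_left[of 0 0 x] by simp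

lemma cinner_zero_right [simp]: "cinner x 0 = 0"
  using cinner_diff_right[of x 0 0] by simp

lemma cinner_eq_0_commute: "cinner x y = 0 \<longleftrightarrow> cinner y x = 0"
  by (metis cinner_commute complex_cnj_zero_iff)

lemma cinner_self_eq_0: "cinner x x = 0 \<longleftrightarrow> x = 0"
  by (simp add: cinner_self)

lemma cinner_ext_left: "(\<And>z. cinner x z = cinner y z) \<Longrightarrow> x = y"
  by (metis cinner_diff_left cinner_self_eq_0 eq_iff_diff_eq_0)

lemma cinner_ext_right: "(\<And>z. cinner z x = cinner z y) \<Longrightarrow> x = y"
  by (metis cinner_diff_right cinner_self_eq_0 eq_iff_diff_eq_0)

lemma Re_cinner_self: "Re (cinner x x) = (norm x)\<^sup>2"
  by (simp only: cinner_self Re_complex_of_real)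

lemma norm_add_sq: "(norm (x + y))\<^sup>2 = (norm x)\<^sup>2 + 2 * Re (cinner x y) + (norm y)\<^sup>2"
  for x y :: "'a::complex_hilbert"
proof -
  have "cinner (x + y) (x + y) = cinner x x + cinner x y + cnj (cinner x y) + cinner y y"
    by (simp add: cinner_add_left cinner_add_right flip: cinner_commute)
  from arg_cong[where f = Re, OF this] show ?thesis by (simp add: Re_cinner_self)
qed

lemma norm_scaleC: "norm (c *\<^sub>C x) = cmod c * norm (x::'a::complex_hilbert)"
proof -
  have "complex_of_real ((norm (c *\<^sub>C x))\<^sup>2) = c * cnj c * complex_of_real ((norm x)\<^sup>2)"
    by (simp only: cinner_self[symmetric] cinner_scaleC_left cinner_scaleC_right ac_simps)
  also have "\<dots> = complex_of_real ((cmod c * norm x)\<^sup>2)"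
    by (simp add: complex_norm_square[symmetric] power_mult_distrib)
  finally have "(norm (c *\<^sub>C x))\<^sup>2 = (cmod c * norm x)\<^sup>2"
    using of_real_eq_iff by blast
  then show ?thesis by (simp add: power2_eq_iff_nonneg)
qed

lemma norm_diff_sq: "(norm (x - y))\<^sup>2 = (norm x)\<^sup>2 - 2 * Re (cinner x y) + (norm y)\<^sup>2"
  for x y :: "'a::complex_hilbert"
  using norm_add_sq[of x "- y"] scaleC_minus1[of y]
  by (metis add_uminus_conv_diff cinner_scaleC_right complex_cnj_minus complex_cnj_one
      minus_complex.simps(1) mult_minus1 mult_minus_right norm_minus_cancel uminus_complex.sel(1))

lemma parallelogram_law:
  "(norm (x - y))\<^sup>2 + (norm (x + y))\<^sup>2 = 2 * (norm x)\<^sup>2 + 2 * (norm y)\<^sup>2"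
  for x y :: "'a::complex_hilbert"
  by (simp add: norm_add_sq norm_diff_sq)

text \<open>The norm already satisfies the triangle inequality.  Squared, it bounds the real part of the
  inner product, and multiplying \<open>x\<close> by a unimodular scalar makes the inner product real.\<close>

lemma Cauchy_Schwarz: "cmod (cinner x y) \<le> norm x * norm (y::'a::complex_hilbert)"
proof (cases "cinner x y = 0")
  case False
  define c where "c = cnj (cinner x y) / complex_of_real (cmod (cinner x y))"
  have c: "cmod c = 1" using False by (simp add: c_def norm_divide)
  have sq: "cnj (cinner x y) * cinner x y
      = complex_of_real (cmod (cinner x y)) * complex_of_real (cmod (cinner x y))"
    using complex_norm_square[of "cinner x y"] by (simp add: power2_eq_square mult.commute)
  have "cinner (c *\<^sub>C x) y = cnj (cinner x y) * cinner x y / complex_of_real (cmod (cinner x y))"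
    by (simp add: cinner_scaleC_left c_def)
  also have "\<dots> = complex_of_real (cmod (cinner x y))"
    unfolding sq using False by simp
  finally have eq: "Re (cinner (c *\<^sub>C x) y) = cmod (cinner x y)" by simp
  have "(norm (c *\<^sub>C x + y))\<^sup>2 \<le> (norm (c *\<^sub>C x) + norm y)\<^sup>2"
    by (intro power_mono norm_triangle_ineq) simp
  then have "Re (cinner (c *\<^sub>C x) y) \<le> norm (c *\<^sub>C x) * norm y"
    by (simp add: norm_add_sq power2_sum)
  then show ?thesis by (simp add: eq norm_scaleC c)
qed simp

lemma bounded_linear_cinner_left: "bounded_linear (\<lambda>x. cinner x (y::'a::complex_hilbert))"
proof (rule bounded_linear_intro[where K = "norm y"])
  show "cinner (r *\<^sub>R x) y = r *\<^sub>R cinner x y" for r x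
    by (metis cinner_scaleC_left scaleC_of_real scaleR_conv_of_real)
qed (auto simp: cinner_add_left Cauchy_Schwarz)

lemma closed_orthogonal: "closed {x. cinner x (y::'a::complex_hilbert) = 0}"
  by (intro closed_Collect_eq continuous_intros
      bounded_linear.continuous_on[OF bounded_linear_cinner_left])

section \<open>The projection theorem\<close>

definition closed_csubspace :: "'a::complex_hilbert set \<Rightarrow> bool" where
  "closed_csubspace M \<longleftrightarrow> closed M \<and> 0 \<in> M \<and> (\<forall>x\<in>M. \<forall>y\<in>M. x + y \<in> M) \<and>
     (\<forall>c. \<forall>x\<in>M. c *\<^sub>C x \<in> M)"

lemma closed_csubspaceI:
  assumes "closed M" "0 \<in> M" "\<And>x y. x \<in> M \<Longrightarrow> y \<in> M \<Longrightarrow> x + y \<in> M"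
    "\<And>c x. x \<in> M \<Longrightarrow> c *\<^sub>C x \<in> M"
  shows "closed_csubspace M"
  using assms by (auto simp: closed_csubspace_def)

lemma closed_csubspace_diff:
  assumes "closed_csubspace M" "x \<in> M" "y \<in> M" shows "x - y \<in> M"
  by (metis add_uminus_conv_diff assms closed_csubspace_def scaleC_minus1)

text \<open>A minimising sequence for the distance from \<open>x\<close> to \<open>M\<close> is Cauchy by the parallelogram law,
  since midpoints of its members stay in \<open>M\<close>.\<close>

lemma nearest_point_exists:
  fixes x :: "'a::complex_hilbert"
  assumes M: "closed_csubspace M"
  obtains m where "m \<in> M" "\<And>y. y \<in> M \<Longrightarrow> norm (x - m) \<le> norm (x - y)"
proof -
  define d where "d = infdist x M"
  have ne: "M \<noteq> {}" using M by (auto simp: closed_csubspace_def)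
  have d0: "0 \<le> d" by (simp add: d_def infdist_nonneg)
  have d_le: "d \<le> norm (x - y)" if "y \<in> M" for y
    unfolding d_def using infdist_le[OF that, of x] by (simp add: dist_norm)
  have "\<exists>y\<in>M. (norm (x - y))\<^sup>2 < d\<^sup>2 + 1 / real (Suc n)" for n
  proof -
    have "d < sqrt (d\<^sup>2 + 1 / real (Suc n))"
      by (rule real_less_rsqrt) simp
    then obtain y where "y \<in> M" "dist x y < sqrt (d\<^sup>2 + 1 / real (Suc n))"
      unfolding d_def infdist_def using ne by (auto simp: cInf_less_iff)
    moreover from this(2) have "(norm (x - y))\<^sup>2 < (sqrt (d\<^sup>2 + 1 / real (Suc n)))\<^sup>2"
      by (intro power_strict_mono) (auto simp: dist_norm)
    ultimately show ?thesis by auto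
  qed
  then obtain m where m: "\<And>n. m n \<in> M"
    and m_lt: "\<And>n. (norm (x - m n))\<^sup>2 < d\<^sup>2 + 1 / real (Suc n)" by metis
  have gap: "(norm (m i - m j))\<^sup>2 \<le> 2 * (1 / real (Suc i)) + 2 * (1 / real (Suc j))" for i j
  proof -
    let ?u = "x - m i" and ?v = "x - m j"
    have par: "(norm (?u - ?v))\<^sup>2 + (norm (?u + ?v))\<^sup>2 = 2 * (norm ?u)\<^sup>2 + 2 * (norm ?v)\<^sup>2"
      by (rule parallelogram_law)
    have mid: "(1/2) *\<^sub>R (m i + m j) \<in> M"
      using M m by (simp add: closed_csubspace_def flip: scaleC_of_real)
    have "?u + ?v = 2 *\<^sub>R (x - (1/2) *\<^sub>R (m i + m j))"
      by (simp add: scaleR_right_diff_distrib scaleR_2)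
    then have "norm (?u + ?v) = 2 * norm (x - (1/2) *\<^sub>R (m i + m j))" by simp
    then have "2 * d \<le> norm (?u + ?v)" using d_le[OF mid] by simp
    then have "(2 * d)\<^sup>2 \<le> (norm (?u + ?v))\<^sup>2" using d0 by (intro power_mono) auto
    then have "4 * d\<^sup>2 \<le> (norm (?u + ?v))\<^sup>2" by (simp add: power_mult_distrib)
    moreover have "?u - ?v = - (m i - m j)" by simp
    then have "norm (?u - ?v) = norm (m i - m j)" by (simp only: norm_minus_cancel)
    ultimately show ?thesis using par m_lt[of i] m_lt[of j] by simp
  qed
  have "Cauchy m"
  proof (rule metric_CauchyI)
    fix e :: real assume e: "0 < e"
    obtain N where N: "1 / real (Suc N) < e\<^sup>2 / 4"
      using e nat_approx_posE[of "e\<^sup>2 / 4"] by auto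
    show "\<exists>N. \<forall>i\<ge>N. \<forall>j\<ge>N. dist (m i) (m j) < e"
    proof (intro exI allI impI)
      fix i j assume "N \<le> i" "N \<le> j"
      then have "1 / real (Suc i) \<le> 1 / real (Suc N)" "1 / real (Suc j) \<le> 1 / real (Suc N)"
        by (auto intro!: divide_left_mono)
      then have "(norm (m i - m j))\<^sup>2 < e\<^sup>2" using gap[of i j] N by linarith
      then show "dist (m i) (m j) < e" using e by (simp add: dist_norm power_less_imp_less_base)
    qed
  qed
  then obtain l where l: "m \<longlonglongrightarrow> l" using convergent_eq_Cauchy by blast
  have lM: "l \<in> M" using M l m closed_sequentially by (auto simp: closed_csubspace_def)
  have lim: "(\<lambda>n. (norm (x - m n))\<^sup>2) \<longlonglongrightarrow> (norm (x - l))\<^sup>2" by (intro tendsto_intros l)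
  have lim': "(\<lambda>n. d\<^sup>2 + 1 / real (Suc n)) \<longlonglongrightarrow> d\<^sup>2 + 0"
    by (intro tendsto_intros LIMSEQ_Suc[OF lim_1_over_n])
  have "(norm (x - l))\<^sup>2 \<le> d\<^sup>2 + 0"
    using m_lt by (intro LIMSEQ_le[OF lim lim']) (blast intro: less_imp_le)
  then have "norm (x - l) \<le> d" using d0 power2_le_imp_le[of "norm (x - l)" d] by simp
  then show thesis using that lM d_le by (meson order_trans)
qed

text \<open>The nearest point \<open>m\<close> will do: were \<open>x - m\<close> not orthogonal to some \<open>y\<close> in \<open>M\<close>, then moving \<open>m\<close>
  by a small multiple of \<open>\<langle>x - m, y\<rangle> y\<close> would decrease the distance.\<close>

lemma orthogonal_decomposition:
  fixes x :: "'a::complex_hilbert"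
  assumes M: "closed_csubspace M"
  obtains m where "m \<in> M" "\<And>y. y \<in> M \<Longrightarrow> cinner (x - m) y = 0"
proof -
  obtain m where m: "m \<in> M" and min: "\<And>y. y \<in> M \<Longrightarrow> norm (x - m) \<le> norm (x - y)"
    using nearest_point_exists[OF M] by metis
  have "cinner (x - m) y = 0" if y: "y \<in> M" for y
  proof -
    define a where "a = cinner (x - m) y"
    \<comment> \<open>Any positive \<open>t\<close> with \<open>t * (norm y)\<^sup>2 < 2\<close> would do.\<close>
    define t where "t = 1 / (1 + (norm y)\<^sup>2)"
    let ?w = "(complex_of_real t * a) *\<^sub>C y"
    have t0: "0 < t" by (simp add: t_def add_pos_nonneg)
    have ty: "t * (norm y)\<^sup>2 \<le> 1" by (simp add: t_def divide_le_eq add_pos_nonneg)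
    have "m + ?w \<in> M" using M m y by (simp add: closed_csubspace_def)
    then have "norm (x - m) \<le> norm (x - m - ?w)" using min by (metis diff_diff_eq)
    then have "(norm (x - m))\<^sup>2 \<le> (norm (x - m - ?w))\<^sup>2" by (simp add: power_mono)
    moreover have "Re (cinner (x - m) ?w) = t * (cmod a)\<^sup>2"
    proof -
      have "cinner (x - m) ?w = complex_of_real t * (a * cnj a)"
        by (simp add: cinner_scaleC_right a_def)
      then show ?thesis by (simp add: complex_norm_square[symmetric] flip: of_real_mult)
    qed
    moreover have "(norm ?w)\<^sup>2 = t * (cmod a)\<^sup>2 * (t * (norm y)\<^sup>2)"
      using t0 by (simp add: norm_scaleC norm_mult power_mult_distrib power2_eq_square)
    ultimately have "2 * (t * (cmod a)\<^sup>2) \<le> t * (cmod a)\<^sup>2 * (t * (norm y)\<^sup>2)"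
      by (simp add: norm_diff_sq)
    also have "\<dots> \<le> t * (cmod a)\<^sup>2" using mult_left_mono[OF ty, of "t * (cmod a)\<^sup>2"] t0 by simp
    finally have "t * (cmod a)\<^sup>2 \<le> 0" by simp
    then show ?thesis using t0 by (simp add: mult_le_0_iff a_def)
  qed
  with m show thesis by (rule that)
qed

section \<open>Adjoints\<close>

lemma bounded_clinearI:
  fixes f :: "'a::complex_hilbert \<Rightarrow> 'b::complex_hilbert"
  assumes "\<And>x y. f (x + y) = f x + f y" "\<And>c x. f (c *\<^sub>C x) = c *\<^sub>C f x"
    "\<And>x. norm (f x) \<le> norm x * K"
  shows "bounded_clinear f"
  unfolding bounded_clinear_def
  using assms by (auto intro!: bounded_linear_intro simp flip: scaleC_of_real)

lemma bounded_clinear_add: "bounded_clinear f \<Longrightarrow> f (x + y) = f x + f y"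
  and bounded_clinear_diff: "bounded_clinear f \<Longrightarrow> f (x - y) = f x - f y"
  and bounded_clinear_scaleC: "bounded_clinear f \<Longrightarrow> f (c *\<^sub>C x) = c *\<^sub>C f x"
  and bounded_clinear_zero: "bounded_clinear f \<Longrightarrow> f 0 = 0"
  by (auto simp: bounded_clinear_def bounded_linear.linear linear_add linear_diff linear_0)

lemma bounded_clinear_continuous_on: "bounded_clinear f \<Longrightarrow> continuous_on S f"
  by (simp add: bounded_clinear_def linear_continuous_on)

lemma bounded_clinear_comp:
  "bounded_clinear f \<Longrightarrow> bounded_clinear g \<Longrightarrow> bounded_clinear (f \<circ> g)"
  by (auto simp: bounded_clinear_def o_def intro: bounded_linear_compose)

lemma bounded_clinear_id: "bounded_clinear (\<lambda>x. x)"
  by (simp add: bounded_clinear_def bounded_linear_ident)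

lemma bounded_clinear_const_0: "bounded_clinear (\<lambda>x. 0)"
  by (simp add: bounded_clinear_def scaleC_zero_right)

text \<open>The representing vector is a multiple of any \<open>w \<noteq> 0\<close> orthogonal to the kernel of \<open>f\<close>, because
  \<open>f w *\<^sub>C x - f x *\<^sub>C w\<close> lies in that kernel.\<close>

lemma Riesz_representation:
  fixes f :: "'a::complex_hilbert \<Rightarrow> complex"
  assumes bl: "bounded_linear f" and sc: "\<And>c x. f (c *\<^sub>C x) = c * f x"
  obtains z where "\<And>x. f x = cinner x z"
proof (cases "\<forall>x. f x = 0")
  case True
  then show thesis using that[of 0] by simp
next
  case False
  then obtain x0 where x0: "f x0 \<noteq> 0" by auto
  let ?K = "{x. f x = 0}"
  have lin: "f (x + y) = f x + f y" "f (x - y) = f x - f y" for x y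
    using bl by (auto simp: bounded_linear.linear linear_add linear_diff)
  have "closed_csubspace ?K"
  proof (rule closed_csubspaceI)
    show "closed ?K"
      by (intro closed_Collect_eq continuous_intros bounded_linear.continuous_on[OF bl])
  qed (auto simp: lin sc linear_0 bounded_linear.linear[OF bl])
  then obtain m where m: "f m = 0" and orth: "\<And>y. f y = 0 \<Longrightarrow> cinner (x0 - m) y = 0"
    using orthogonal_decomposition[of ?K x0] by auto
  define w where "w = x0 - m"
  have fw: "f w \<noteq> 0" using x0 m by (simp add: w_def lin)
  then have w0: "w \<noteq> 0" using bl by (auto simp: bounded_linear.linear linear_0)
  show thesis
  proof (rule that)
    fix x
    have "f (f w *\<^sub>C x - f x *\<^sub>C w) = 0" by (simp add: lin sc)
    then have "cinner (f w *\<^sub>C x - f x *\<^sub>C w) w = 0"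
      using orth cinner_eq_0_commute unfolding w_def by blast
    then have "f w * cinner x w = f x * cinner w w"
      by (simp add: cinner_diff_left cinner_scaleC_left)
    then show "f x = cinner x (cnj (f w / cinner w w) *\<^sub>C w)"
      using w0 by (simp add: cinner_scaleC_right cinner_self_eq_0 field_simps)
  qed
qed

lemma cadjointI:
  assumes "\<And>x y. cinner (T x) y = cinner x (S y)"
  shows "cadjoint T = S"
  unfolding cadjoint_def
proof (rule the_equality)
  fix S' assume "\<forall>x y. cinner (T x) y = cinner x (S' y)"
  then show "S' = S" using assms by (metis cinner_ext_right ext)
qed (use assms in blast)

lemma cinner_cadjoint:
  assumes T: "bounded_clinear T"
  shows "cinner (T x) y = cinner x (cadjoint T y)"
proof -
  have "\<exists>z. \<forall>x. cinner (T x) y = cinner x z" for y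
  proof -
    have "bounded_linear (\<lambda>x. cinner (T x) y)"
      using T bounded_linear_compose[OF bounded_linear_cinner_left]
      by (auto simp: bounded_clinear_def)
    then show ?thesis
      using Riesz_representation[of "\<lambda>x. cinner (T x) y"] T
      by (metis bounded_clinear_def cinner_scaleC_left)
  qed
  then obtain S where S: "\<And>x y. cinner (T x) y = cinner x (S y)" by metis
  then have "cadjoint T = S" by (rule cadjointI)
  then show ?thesis by (simp add: S)
qed

lemma bounded_clinear_cadjoint:
  assumes T: "bounded_clinear T"
  shows "bounded_clinear (cadjoint T)"
proof -
  note adj = cinner_cadjoint[OF T, symmetric]
  obtain K where K: "\<And>x. norm (T x) \<le> norm x * K" "0 \<le> K"
    using T bounded_linear.nonneg_bounded unfolding bounded_clinear_def by metis
  show ?thesis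
  proof (rule bounded_clinearI)
    show "cadjoint T (x + y) = cadjoint T x + cadjoint T y" for x y
      by (rule cinner_ext_right) (simp add: adj cinner_add_right)
    show "cadjoint T (c *\<^sub>C x) = c *\<^sub>C cadjoint T x" for c x
      by (rule cinner_ext_right) (simp add: adj cinner_scaleC_right)
    fix y
    let ?z = "cadjoint T y"
    have "(norm ?z)\<^sup>2 = cmod (cinner (T ?z) y)" by (simp add: adj[symmetric] cinner_self norm_power)
    also have "\<dots> \<le> norm (T ?z) * norm y" by (rule Cauchy_Schwarz)
    also have "\<dots> \<le> norm ?z * K * norm y" by (intro mult_right_mono K) simp
    finally have "norm ?z * norm ?z \<le> norm ?z * (norm y * K)"
      by (simp add: power2_eq_square ac_simps)
    then show "norm ?z \<le> norm y * K"
      using K(2) by (cases "?z = 0") auto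
  qed
qed

section \<open>Projections and closed subspaces\<close>

lemma ProjsI:
  assumes "bounded_clinear P" "\<And>x. P (P x) = P x" "\<And>x y. cinner (P x) y = cinner x (P y)"
  shows "P \<in> Projs"
  using assms by (auto simp: Projs_def intro: cadjointI)

lemma Projs_bounded: "P \<in> Projs \<Longrightarrow> bounded_clinear P"
  by (simp add: Projs_def)

lemma Projs_idem: "P \<in> Projs \<Longrightarrow> P (P x) = P x"
  by (auto simp: Projs_def o_def fun_eq_iff)

lemma Projs_sym: "P \<in> Projs \<Longrightarrow> cinner (P x) y = cinner x (P y)"
  using cinner_cadjoint[of P] by (simp add: Projs_def)

lemma Projs_in_range_iff: "P \<in> Projs \<Longrightarrow> x \<in> range P \<longleftrightarrow> P x = x"
  by (metis Projs_idem rangeE rangeI)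

lemma closed_csubspace_range:
  assumes P: "P \<in> Projs" shows "closed_csubspace (range P)"
proof -
  note bc = Projs_bounded[OF P]
  have "range P = {x. P x = x}" using Projs_in_range_iff[OF P] by blast
  moreover have "closed {x. P x = x}"
    by (intro closed_Collect_eq bounded_clinear_continuous_on[OF bc] continuous_on_id)
  ultimately show ?thesis
    by (intro closed_csubspaceI)
      (auto simp: bounded_clinear_add[OF bc] bounded_clinear_scaleC[OF bc] bounded_clinear_zero[OF bc])
qed

lemma Projs_eqI:
  assumes P: "P \<in> Projs" and Q: "Q \<in> Projs" and "range P = range Q"
  shows "P = Q"
proof
  fix x
  have PQ: "P (Q z) = Q z" "Q (P z) = P z" for z
    using assms Projs_in_range_iff by blast+
  show "P x = Q x"
    by (rule cinner_ext_left) (metis P PQ Q Projs_sym)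
qed

definition proj_onto :: "'a::complex_hilbert set \<Rightarrow> 'a \<Rightarrow> 'a" where
  "proj_onto M x = (THE m. m \<in> M \<and> (\<forall>y\<in>M. cinner (x - m) y = 0))"

lemma proj_onto_eqI:
  assumes M: "closed_csubspace M" and "m \<in> M" "\<And>y. y \<in> M \<Longrightarrow> cinner (x - m) y = 0"
  shows "proj_onto M x = m"
  unfolding proj_onto_def
proof (rule the_equality)
  fix m' assume m': "m' \<in> M \<and> (\<forall>y\<in>M. cinner (x - m') y = 0)"
  have d: "m' - m \<in> M" using closed_csubspace_diff[OF M] m' assms(2) by blast
  have "cinner (m' - m) (m' - m) = cinner (x - m) (m' - m) - cinner (x - m') (m' - m)"
    by (simp flip: cinner_diff_left)
  then have "cinner (m' - m) (m' - m) = 0" using assms(3) m' d by simp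
  then show "m' = m" by (simp add: cinner_self_eq_0)
qed (use assms in blast)

lemma
  assumes M: "closed_csubspace M"
  shows proj_onto_mem: "proj_onto M x \<in> M"
    and proj_onto_orth: "y \<in> M \<Longrightarrow> cinner (x - proj_onto M x) y = 0"
proof -
  obtain m where "m \<in> M" "\<And>y. y \<in> M \<Longrightarrow> cinner (x - m) y = 0"
    using orthogonal_decomposition[OF M] by metis
  moreover from this have "proj_onto M x = m" by (rule proj_onto_eqI[OF M])
  ultimately show "proj_onto M x \<in> M" "y \<in> M \<Longrightarrow> cinner (x - proj_onto M x) y = 0" by auto
qed

lemma proj_onto_ident: "closed_csubspace M \<Longrightarrow> x \<in> M \<Longrightarrow> proj_onto M x = x"
  by (rule proj_onto_eqI) auto

lemma range_proj_onto: "closed_csubspace M \<Longrightarrow> range (proj_onto M) = M"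
  by (metis UNIV_I image_subset_iff proj_onto_ident proj_onto_mem rangeI subsetI subset_antisym)

lemma proj_onto_in_Projs:
  assumes M: "closed_csubspace M"
  shows "proj_onto M \<in> Projs"
proof (rule ProjsI)
  let ?P = "proj_onto M"
  note mem = proj_onto_mem[OF M] and orth = proj_onto_orth[OF M]
  show sym: "cinner (?P x) y = cinner x (?P y)" for x y
  proof -
    have "cinner (x - ?P x) (?P y) = 0" "cinner (?P x) (y - ?P y) = 0"
      using mem orth cinner_eq_0_commute by blast+
    then show ?thesis by (simp add: cinner_diff_left cinner_diff_right)
  qed
  show "bounded_clinear ?P"
  proof (rule bounded_clinearI)
    show "?P (x + y) = ?P x + ?P y" for x y
      by (rule cinner_ext_left) (simp add: sym cinner_add_left)
    show "?P (c *\<^sub>C x) = c *\<^sub>C ?P x" for c x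
      by (rule cinner_ext_left) (simp add: sym cinner_scaleC_left)
    show "norm (?P x) \<le> norm x * 1" for x
    proof -
      \<comment> \<open>Pythagoras for \<open>x = ?P x + (x - ?P x)\<close>.\<close>
      have "cinner (?P x) (x - ?P x) = 0" using orth[OF mem] cinner_eq_0_commute by blast
      then have "(norm (?P x + (x - ?P x)))\<^sup>2 = (norm (?P x))\<^sup>2 + (norm (x - ?P x))\<^sup>2"
        by (simp only: norm_add_sq) simp
      then have "(norm (?P x))\<^sup>2 \<le> (norm x)\<^sup>2" by simp
      then show ?thesis using power2_le_imp_le[of "norm (?P x)" "norm x"] by simp
    qed
  qed
  show "?P (?P x) = ?P x" for x by (rule proj_onto_ident[OF M mem])
qed

definition closed_span :: "'a::complex_hilbert set \<Rightarrow> 'a set" where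
  "closed_span X = closed_csubspace hull X"

lemma closed_csubspace_closed_span: "closed_csubspace (closed_span X)"
  unfolding closed_span_def
  by (rule hull_in) (auto simp: closed_csubspace_def intro: closed_Inter)

lemma closed_span_superset: "X \<subseteq> closed_span X"
  by (simp add: closed_span_def hull_subset)

lemma closed_span_subset_iff: "closed_csubspace N \<Longrightarrow> closed_span X \<subseteq> N \<longleftrightarrow> X \<subseteq> N"
  by (metis closed_span_def closed_span_superset hull_minimal order_trans)

section \<open>Suprema of projections\<close>

lemma is_proj_Sup_unique:
  assumes "is_proj_Sup F S" "is_proj_Sup F S'"
  shows "S = S'"
proof (rule Projs_eqI)
  have "proj_le S S'" "proj_le S' S" using assms unfolding is_proj_Sup_def by blast+
  then show "range S = range S'" unfolding proj_le_def by (rule subset_antisym)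
qed (use assms in \<open>auto simp: is_proj_Sup_def\<close>)

lemma proj_Sup_eqI: "is_proj_Sup F S \<Longrightarrow> proj_Sup F = S"
  unfolding proj_Sup_def by (blast intro: is_proj_Sup_unique)

lemma is_proj_Sup_proj_Sup: "is_proj_Sup F (proj_Sup F)"
proof -
  let ?M = "closed_span (\<Union>P\<in>F. range P)"
  have M: "closed_csubspace ?M" by (rule closed_csubspace_closed_span)
  have "is_proj_Sup F (proj_onto ?M)"
    unfolding is_proj_Sup_def proj_le_def range_proj_onto[OF M]
  proof (intro conjI ballI impI)
    show "range P \<subseteq> ?M" if "P \<in> F" for P
      using that by (intro order_trans[OF _ closed_span_superset]) blast
    show "?M \<subseteq> range R" if "R \<in> Projs" "\<forall>P\<in>F. range P \<subseteq> range R" for R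
      using that by (auto simp: closed_span_subset_iff closed_csubspace_range)
  qed (rule proj_onto_in_Projs[OF M])
  then show ?thesis using proj_Sup_eqI by metis
qed

lemma proj_Sup_le_iff:
  assumes "N \<in> Projs"
  shows "proj_le (proj_Sup F) N \<longleftrightarrow> (\<forall>P\<in>F. proj_le P N)"
  using is_proj_Sup_proj_Sup[of F] assms unfolding is_proj_Sup_def proj_le_def by blast

lemma proj_Sup_in_Projs: "proj_Sup F \<in> Projs"
  using is_proj_Sup_proj_Sup[of F] by (simp add: is_proj_Sup_def)

section \<open>The sup-preserving map of a family of operators\<close>

text \<open>This is the map of Erdos attached to the operators in \<open>U\<close>.\<close>

definition sup_map ::
  "('a::complex_hilbert \<Rightarrow> 'b::complex_hilbert) set \<Rightarrow> ('a \<Rightarrow> 'a) \<Rightarrow> ('b \<Rightarrow> 'b)" where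
  "sup_map U = (\<lambda>P\<in>Projs. proj_onto (closed_span (\<Union>S\<in>U. S ` range P)))"

definition sup_map_upper ::
  "('a::complex_hilbert \<Rightarrow> 'b::complex_hilbert) set \<Rightarrow> ('b \<Rightarrow> 'b) \<Rightarrow> ('a \<Rightarrow> 'a)" where
  "sup_map_upper U Q = proj_onto {x. \<forall>S\<in>U. S x \<in> range Q}"

lemma sup_map_in_Projs: "P \<in> Projs \<Longrightarrow> sup_map U P \<in> Projs"
  by (simp add: sup_map_def proj_onto_in_Projs closed_csubspace_closed_span)

lemma range_sup_map:
  "P \<in> Projs \<Longrightarrow> range (sup_map U P) = closed_span (\<Union>S\<in>U. S ` range P)"
  by (simp add: sup_map_def range_proj_onto closed_csubspace_closed_span)

lemma closed_csubspace_vimage: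
  assumes "bounded_clinear S" "closed_csubspace N"
  shows "closed_csubspace (S -` N)"
proof (rule closed_csubspaceI)
  show "closed (S -` N)"
    using assms bounded_clinear_continuous_on[of S UNIV]
    by (auto simp: closed_csubspace_def intro: closed_vimage)
qed (use assms in \<open>auto simp: closed_csubspace_def bounded_clinear_add bounded_clinear_scaleC
    bounded_clinear_zero\<close>)

lemma closed_csubspace_common_vimage:
  assumes "\<And>S. S \<in> U \<Longrightarrow> bounded_clinear S" "closed_csubspace N"
  shows "closed_csubspace {x. \<forall>S\<in>U. S x \<in> N}"
proof -
  have "\<And>S. S \<in> U \<Longrightarrow> closed_csubspace (S -` N)" using assms closed_csubspace_vimage by blast
  then have "closed_csubspace (\<Inter>S\<in>U. S -` N)" by (auto simp: closed_csubspace_def)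
  also have "(\<Inter>S\<in>U. S -` N) = {x. \<forall>S\<in>U. S x \<in> N}" by auto
  finally show ?thesis .
qed

lemma
  assumes "\<And>S. S \<in> U \<Longrightarrow> bounded_clinear S" "Q \<in> Projs"
  shows sup_map_upper_in_Projs: "sup_map_upper U Q \<in> Projs"
    and range_sup_map_upper: "range (sup_map_upper U Q) = {x. \<forall>S\<in>U. S x \<in> range Q}"
  using closed_csubspace_common_vimage[OF assms(1) closed_csubspace_range[OF assms(2)]]
  by (simp_all add: sup_map_upper_def range_proj_onto proj_onto_in_Projs)

lemma sup_map_galois:
  assumes "\<And>S. S \<in> U \<Longrightarrow> bounded_clinear S" "P \<in> Projs" "Q \<in> Projs"
  shows "proj_le (sup_map U P) Q \<longleftrightarrow> proj_le P (sup_map_upper U Q)"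
proof -
  have upper: "range (sup_map_upper U Q) = {x. \<forall>S\<in>U. S x \<in> range Q}"
    using assms(1,3) by (rule range_sup_map_upper)
  have "proj_le (sup_map U P) Q \<longleftrightarrow> (\<Union>S\<in>U. S ` range P) \<subseteq> range Q"
    using assms by (simp add: proj_le_def range_sup_map closed_span_subset_iff closed_csubspace_range)
  also have "\<dots> \<longleftrightarrow> proj_le P (sup_map_upper U Q)"
    unfolding proj_le_def upper by blast
  finally show ?thesis .
qed

text \<open>A lower adjoint preserves all suprema.\<close>

lemma sup_map_in_sup_maps:
  assumes U: "\<And>S. S \<in> U \<Longrightarrow> bounded_clinear S"
  shows "sup_map U \<in> sup_maps"
proof -
  have P0: "(\<lambda>x. 0) \<in> Projs" by (rule ProjsI) (auto simp: bounded_clinear_const_0)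
  have "sup_map U \<in> Projs \<rightarrow>\<^sub>E Projs"
    by (rule PiE_I) (simp_all add: sup_map_in_Projs, simp add: sup_map_def)
  moreover have "sup_map U (\<lambda>x. 0) = (\<lambda>x. 0)"
  proof (rule Projs_eqI)
    have "proj_le (sup_map U (\<lambda>x. 0)) (\<lambda>x. 0)"
      using U by (simp add: sup_map_galois P0 range_sup_map_upper)
        (auto simp: proj_le_def range_sup_map_upper P0 U bounded_clinear_zero)
    moreover have "0 \<in> range (sup_map U (\<lambda>x. 0))"
      using closed_csubspace_range[OF sup_map_in_Projs[OF P0]] by (auto simp: closed_csubspace_def)
    ultimately show "range (sup_map U (\<lambda>x. 0)) = range (\<lambda>x. 0)" by (auto simp: proj_le_def)
  qed (simp_all add: P0 sup_map_in_Projs)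
  moreover have "sup_map U (proj_Sup F) = proj_Sup (sup_map U ` F)" if F: "F \<subseteq> Projs" for F
  proof -
    \<comment> \<open>Both sides have the same upper bounds.\<close>
    have le_iff: "proj_le (sup_map U (proj_Sup F)) R \<longleftrightarrow> (\<forall>P\<in>F. proj_le (sup_map U P) R)"
      if R: "R \<in> Projs" for R
    proof -
      have "proj_le (sup_map U (proj_Sup F)) R \<longleftrightarrow> (\<forall>P\<in>F. proj_le P (sup_map_upper U R))"
        using U R by (simp add: sup_map_galois proj_Sup_in_Projs proj_Sup_le_iff sup_map_upper_in_Projs)
      also have "\<dots> \<longleftrightarrow> (\<forall>P\<in>F. proj_le (sup_map U P) R)"
        using F R U sup_map_galois[OF U] by blast
      finally show ?thesis .
    qed
    have "is_proj_Sup (sup_map U ` F) (sup_map U (proj_Sup F))"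
      unfolding is_proj_Sup_def
      using le_iff[of "sup_map U (proj_Sup F)"] le_iff
      by (auto simp: sup_map_in_Projs proj_Sup_in_Projs proj_le_def)
    then show ?thesis using proj_Sup_eqI by metis
  qed
  ultimately show ?thesis by (simp add: sup_maps_def)
qed

lemma proj_Sup_sup_map_le:
  assumes U: "\<And>S. S \<in> U \<Longrightarrow> bounded_clinear S" and Q: "Q \<in> Projs"
  shows "proj_Sup {P \<in> Projs. proj_le (sup_map U P) Q} = sup_map_upper U Q"
proof -
  have u: "sup_map_upper U Q \<in> Projs" by (rule sup_map_upper_in_Projs[OF U Q])
  have eq: "{P \<in> Projs. proj_le (sup_map U P) Q} = {P \<in> Projs. proj_le P (sup_map_upper U Q)}"
    using sup_map_galois[OF U _ Q] by blast
  show ?thesis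
    unfolding eq by (rule proj_Sup_eqI) (auto simp: is_proj_Sup_def u proj_le_def)
qed

section \<open>Reflexive algebras and invariant subspaces\<close>

lemma perp_comp_eq_0_iff:
  assumes "L \<in> Projs"
  shows "perp L \<circ> A \<circ> L = (\<lambda>x. 0) \<longleftrightarrow> (\<forall>x. L x = x \<longrightarrow> L (A x) = A x)"
  by (auto simp: perp_def fun_eq_iff Projs_idem[OF assms]) metis

lemma Lat_iff: "L \<in> Lat \<A> \<longleftrightarrow> L \<in> Projs \<and> (\<forall>A\<in>\<A>. \<forall>x. L x = x \<longrightarrow> L (A x) = A x)"
  by (auto simp: Lat_def perp_comp_eq_0_iff)

lemma reflexive_algebra_iff:
  assumes "reflexive_algebra \<A>"
  shows "A \<in> \<A> \<longleftrightarrow> bounded_clinear A \<and> (\<forall>L\<in>Lat \<A>. \<forall>x. L x = x \<longrightarrow> L (A x) = A x)"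
proof -
  have "A \<in> \<A> \<longleftrightarrow> A \<in> Alg (Lat \<A>)" using assms by (simp add: reflexive_algebra_def)
  then show ?thesis by (auto simp: Alg_def perp_comp_eq_0_iff Lat_iff)
qed

lemma reflexive_algebra_bounded: "reflexive_algebra \<A> \<Longrightarrow> A \<in> \<A> \<Longrightarrow> bounded_clinear A"
  by (simp add: reflexive_algebra_iff)

lemma reflexive_algebra_id: "reflexive_algebra \<A> \<Longrightarrow> (\<lambda>x. x) \<in> \<A>"
  by (simp add: reflexive_algebra_iff bounded_clinear_id)

lemma reflexive_algebra_comp:
  "reflexive_algebra \<A> \<Longrightarrow> A \<in> \<A> \<Longrightarrow> A' \<in> \<A> \<Longrightarrow> A \<circ> A' \<in> \<A>"
  by (simp add: reflexive_algebra_iff[of \<A> "A \<circ> A'"] bounded_clinear_comp reflexive_algebra_bounded)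
    (auto simp: reflexive_algebra_iff)

section \<open>Spaces of intertwiners\<close>

text \<open>\<open>L\<close> and \<open>Q\<close> split their spaces into range and kernel, and \<open>T\<close> intertwines them exactly if it
  respects the two splittings.  In this form the condition concerns one vector at a time.\<close>

lemma intertwines_iff:
  assumes L: "L \<in> Projs" and Q: "Q \<in> Projs" and T: "bounded_clinear T"
  shows "T \<circ> L = Q \<circ> T \<longleftrightarrow>
    (\<forall>x. Q (T (L x)) = T (L x)) \<and> (\<forall>x. Q (T (x - L x)) = 0)"
proof
  assume "T \<circ> L = Q \<circ> T"
  then have "T (L x) = Q (T x)" for x by (auto simp: fun_eq_iff)
  then show "(\<forall>x. Q (T (L x)) = T (L x)) \<and> (\<forall>x. Q (T (x - L x)) = 0)"
    using Projs_idem[OF Q] Projs_idem[OF L]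
    by (simp add: bounded_clinear_diff[OF T] bounded_clinear_diff[OF Projs_bounded[OF Q]])
next
  assume "(\<forall>x. Q (T (L x)) = T (L x)) \<and> (\<forall>x. Q (T (x - L x)) = 0)"
  then show "T \<circ> L = Q \<circ> T"
    unfolding fun_eq_iff comp_apply bounded_clinear_diff[OF T]
      bounded_clinear_diff[OF Projs_bounded[OF Q]] by (metis eq_iff_diff_eq_0)
qed

lemma cadjoint_intertwines:
  assumes L: "L \<in> Projs" and Q: "Q \<in> Projs" and T: "bounded_clinear T"
    and TL: "\<And>x. T (L x) = Q (T x)"
  shows "cadjoint T (Q y) = L (cadjoint T y)"
proof (rule cinner_ext_right)
  fix z
  show "cinner z (cadjoint T (Q y)) = cinner z (L (cadjoint T y))"
    by (metis L Q T TL Projs_sym cinner_cadjoint)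
qed

lemma operator_subspace_intertwiners:
  assumes \<phi>: "\<And>L. L \<in> \<L> \<Longrightarrow> \<phi> L \<in> Projs"
  shows "operator_subspace (intertwiners \<L> \<phi>)"
proof -
  have b: "bounded_clinear (\<phi> L)" if "L \<in> \<L>" for L using \<phi>[OF that] by (rule Projs_bounded)
  have "bounded_clinear (\<lambda>x. S x + T x)" if "bounded_clinear S" "bounded_clinear T"
    for S T :: "'a \<Rightarrow> 'b"
    using that by (auto simp: bounded_clinear_def bounded_linear_add scaleC_add_right)
  moreover have "bounded_clinear (\<lambda>x. c *\<^sub>C T x)" if T: "bounded_clinear T"
    for c and T :: "'a \<Rightarrow> 'b"
  proof -
    have "bounded_clinear (\<lambda>y::'b. c *\<^sub>C y)"
      by (rule bounded_clinearI[where K = "cmod c"])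
        (auto simp: scaleC_add_right scaleC_scaleC norm_scaleC mult.commute)
    from bounded_clinear_comp[OF this T] show ?thesis by (simp add: o_def)
  qed
  ultimately show ?thesis
    by (auto simp: operator_subspace_def intertwiners_def fun_eq_iff bounded_clinear_const_0
        bounded_clinear_add[OF b] bounded_clinear_scaleC[OF b] bounded_clinear_zero[OF b])
qed

text \<open>For fixed \<open>x\<close>, all \<open>S\<close> in the space send \<open>L x\<close> into the range of \<open>\<phi> L\<close> and \<open>x - L x\<close> into its
  kernel.  These sets are closed, so every \<open>T\<close> with \<open>T x\<close> in the closure of the orbit of \<open>x\<close>, for
  all \<open>x\<close>, does the same.\<close>

lemma reflexive_intertwiners:
  assumes \<L>: "\<L> \<subseteq> Projs" and \<phi>: "\<And>L. L \<in> \<L> \<Longrightarrow> \<phi> L \<in> Projs"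
  shows "reflexive_subspace (intertwiners \<L> \<phi>)"
proof -
  let ?U = "intertwiners \<L> \<phi>"
  have "T \<in> ?U" if T: "bounded_clinear T" and cl: "\<forall>x. T x \<in> closure {S x |S. S \<in> ?U}" for T
  proof -
    have "T \<circ> L = \<phi> L \<circ> T" if L: "L \<in> \<L>" for L
    proof -
      have pL: "L \<in> Projs" and pQ: "\<phi> L \<in> Projs" using \<L> \<phi> L by auto
      note cont = bounded_clinear_continuous_on[OF Projs_bounded[OF pQ]]
      have S: "\<phi> L (S (L x)) = S (L x)" "\<phi> L (S (x - L x)) = 0" if "S \<in> ?U" for S x
        using that L intertwines_iff[OF pL pQ, of S] by (auto simp: intertwiners_def)
      have "closure {S (L x) |S. S \<in> ?U} \<subseteq> {y. \<phi> L y = y}" for x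
        by (intro closure_minimal closed_Collect_eq cont continuous_on_id) (auto simp: S)
      moreover have "closure {S (x - L x) |S. S \<in> ?U} \<subseteq> {y. \<phi> L y = 0}" for x
        by (intro closure_minimal closed_Collect_eq cont continuous_on_const) (auto simp: S)
      ultimately show ?thesis
        unfolding intertwines_iff[OF pL pQ T] using cl by blast
    qed
    then show ?thesis using T by (simp add: intertwiners_def)
  qed
  then show ?thesis
    using operator_subspace_intertwiners[of \<L> \<phi>] \<phi> by (simp add: reflexive_subspace_def)
qed

lemma normalizing_intertwiners:
  assumes \<L>: "\<L> \<subseteq> Projs" and \<phi>: "\<And>L. L \<in> \<L> \<Longrightarrow> \<phi> L \<in> Projs"
  shows "normalizing_subspace (intertwiners \<L> \<phi>)"
proof -
  let ?U = "intertwiners \<L> \<phi>"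
  have "A \<circ> cadjoint B \<circ> C \<in> ?U" if ABC: "A \<in> ?U" "B \<in> ?U" "C \<in> ?U" for A B C
  proof -
    have bd: "bounded_clinear A" "bounded_clinear B" "bounded_clinear C"
      using ABC by (auto simp: intertwiners_def)
    have "A (cadjoint B (C (L x))) = \<phi> L (A (cadjoint B (C x)))" if L: "L \<in> \<L>" for L x
    proof -
      have tw: "S (L y) = \<phi> L (S y)" if "S \<in> ?U" for S y
        using that L by (auto simp: intertwiners_def fun_eq_iff)
      have "cadjoint B (\<phi> L (C x)) = L (cadjoint B (C x))"
        using L \<L> \<phi> bd(2) tw[OF ABC(2)] by (intro cadjoint_intertwines) auto
      then show ?thesis using tw ABC by metis
    qed
    then show ?thesis
      using bd by (simp add: intertwiners_def bounded_clinear_comp bounded_clinear_cadjoint fun_eq_iff)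
  qed
  then show ?thesis
    using operator_subspace_intertwiners[of \<L> \<phi>] \<phi> by (simp add: normalizing_subspace_def)
qed

section \<open>Semi-normalizers as intertwiners\<close>

lemma sandwich_bounded:
  assumes "reflexive_algebra \<A>" "reflexive_algebra \<B>" "bounded_clinear T"
    "S \<in> {B \<circ> T \<circ> A |A B. A \<in> \<A> \<and> B \<in> \<B>}"
  shows "bounded_clinear S"
  using assms by (auto intro!: bounded_clinear_comp reflexive_algebra_bounded)

lemma sup_map_sandwich_between:
  assumes \<A>: "reflexive_algebra \<A>" and \<B>: "reflexive_algebra \<B>" and T: "bounded_clinear T"
  defines "U \<equiv> {B \<circ> T \<circ> A |A B. A \<in> \<A> \<and> B \<in> \<B>}"
  shows "sup_map U \<in> sup_maps_between (Lat \<A>) (Lat \<B>)"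
proof -
  have U: "\<And>S. S \<in> U \<Longrightarrow> bounded_clinear S"
    using sandwich_bounded[OF \<A> \<B> T] by (simp add: U_def)
  have "sup_map_upper U Q \<in> Lat \<A>" if Q: "Q \<in> Projs" for Q
    unfolding Lat_iff
  proof (intro conjI ballI allI impI)
    show p: "sup_map_upper U Q \<in> Projs" by (rule sup_map_upper_in_Projs[OF U Q])
    fix A x assume A: "A \<in> \<A>" and "sup_map_upper U Q x = x"
    then have x: "\<forall>S\<in>U. S x \<in> range Q"
      using Projs_in_range_iff[OF p] range_sup_map_upper[OF U Q] by blast
    have "S (A x) \<in> range Q" if S: "S \<in> U" for S
    proof -
      obtain A' B where "A' \<in> \<A>" "B \<in> \<B>" "S = B \<circ> T \<circ> A'" using S by (auto simp: U_def)
      then have "S \<circ> A \<in> U"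
        using reflexive_algebra_comp[OF \<A> _ A] by (auto simp: U_def comp_assoc)
      then show ?thesis using x by fastforce
    qed
    then show "sup_map_upper U Q (A x) = A x"
      using Projs_in_range_iff[OF p] range_sup_map_upper[OF U Q] by blast
  qed
  then have "S1 (sup_map U) \<subseteq> Lat \<A>"
    by (auto simp: S1_def proj_Sup_sup_map_le[OF U])
  moreover have "sup_map U P \<in> Lat \<B>" if P: "P \<in> Projs" for P
    unfolding Lat_iff
  proof (intro conjI ballI allI impI)
    show p: "sup_map U P \<in> Projs" by (rule sup_map_in_Projs[OF P])
    fix B y assume B: "B \<in> \<B>" and y: "sup_map U P y = y"
    have "range (sup_map U P) \<subseteq> B -` range (sup_map U P)"
      unfolding range_sup_map[OF P]
    proof (subst closed_span_subset_iff)
      show "closed_csubspace (B -` closed_span (\<Union>S\<in>U. S ` range P))"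
        by (intro closed_csubspace_vimage reflexive_algebra_bounded[OF \<B> B] closed_csubspace_closed_span)
      have "B \<circ> S \<in> U" if S: "S \<in> U" for S
      proof -
        obtain A B' where "A \<in> \<A>" "B' \<in> \<B>" "S = B' \<circ> T \<circ> A" using S by (auto simp: U_def)
        then show ?thesis
          using reflexive_algebra_comp[OF \<B> B] by (auto simp: U_def simp flip: comp_assoc)
      qed
      then have "B (S (P x)) \<in> (\<Union>S\<in>U. S ` range P)" if "S \<in> U" for S x
        using that by fastforce
      then have "(\<Union>S\<in>U. S ` range P) \<subseteq> B -` (\<Union>S\<in>U. S ` range P)" by blast
      also have "\<dots> \<subseteq> B -` closed_span (\<Union>S\<in>U. S ` range P)"
        by (intro vimage_mono closed_span_superset)
      finally show "(\<Union>S\<in>U. S ` range P) \<subseteq> B -` closed_span (\<Union>S\<in>U. S ` range P)" .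
    qed
    then show "sup_map U P (B y) = B y" using y Projs_in_range_iff[OF p] by blast
  qed
  then have "S2 (sup_map U) \<subseteq> Lat \<B>" by (auto simp: S2_def)
  ultimately show ?thesis using sup_map_in_sup_maps[OF U] by (simp add: sup_maps_between_def)
qed

text \<open>The vector \<open>T (x - L x)\<close> has to be orthogonal to all \<open>B T A L y\<close>.  Passing to the adjoint turns
  their inner product into that of \<open>x - L x\<close> with \<open>T\<^sup>* B T A L y\<close>.  The latter vector lies in the
  range of \<open>L\<close>, which both \<open>A\<close> and \<open>T\<^sup>* B T\<close> leave invariant, and the former is orthogonal to it.\<close>

lemma semi_normalizer_intertwines:
  assumes \<A>: "reflexive_algebra \<A>" and \<B>: "reflexive_algebra \<B>" and T: "T \<in> SN \<B> \<A>"
  shows "T \<in> intertwiners (Lat \<A>) (sup_map {B \<circ> T \<circ> A |A B. A \<in> \<A> \<and> B \<in> \<B>})"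
proof -
  let ?U = "{B \<circ> T \<circ> A |A B. A \<in> \<A> \<and> B \<in> \<B>}"
  have bT: "bounded_clinear T" using T by (simp add: SN_def)
  have "T \<circ> L = sup_map ?U L \<circ> T" if L: "L \<in> Lat \<A>" for L
  proof -
    have pL: "L \<in> Projs" using L by (simp add: Lat_iff)
    let ?Q = "sup_map ?U L"
    have pQ: "?Q \<in> Projs" by (rule sup_map_in_Projs[OF pL])
    have "?Q (T (L x)) = T (L x)" for x
    proof -
      have "T \<in> ?U"
        using reflexive_algebra_id[OF \<A>] reflexive_algebra_id[OF \<B>] by (force simp: o_def)
      then have "T (L x) \<in> (\<Union>S\<in>?U. S ` range L)" by blast
      then have "T (L x) \<in> range ?Q"
        unfolding range_sup_map[OF pL] by (rule subsetD[OF closed_span_superset])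
      then show ?thesis using Projs_in_range_iff[OF pQ] by blast
    qed
    moreover have "?Q (T (x - L x)) = 0" for x
    proof -
      let ?v = "T (x - L x)"
      let ?N = "{y. cinner y ?v = 0}"
      have N: "closed_csubspace ?N"
        by (rule closed_csubspaceI) (auto simp: closed_orthogonal cinner_add_left cinner_scaleC_left)
      have "cinner (B (T (A (L y)))) ?v = 0" if "A \<in> \<A>" "B \<in> \<B>" for A B y
      proof -
        have 1: "L (A (L y)) = A (L y)" using L that Projs_idem[OF pL] by (auto simp: Lat_iff)
        have "cadjoint T \<circ> B \<circ> T \<in> \<A>" using T that by (simp add: SN_def)
        then have 2: "L (cadjoint T (B (T (A (L y))))) = cadjoint T (B (T (A (L y))))"
          using L 1 by (auto simp: Lat_iff)
        have "cinner ?v (B (T (A (L y)))) = cinner (x - L x) (cadjoint T (B (T (A (L y)))))"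
          by (rule cinner_cadjoint[OF bT])
        also have "\<dots> = cinner (L (x - L x)) (cadjoint T (B (T (A (L y)))))"
          by (metis 2 Projs_sym[OF pL])
        also have "\<dots> = 0"
          by (simp add: bounded_clinear_diff[OF Projs_bounded[OF pL]] Projs_idem[OF pL])
        finally show ?thesis using cinner_eq_0_commute by blast
      qed
      then have "(\<Union>S\<in>?U. S ` range L) \<subseteq> ?N" by auto
      then have "range ?Q \<subseteq> ?N"
        unfolding range_sup_map[OF pL] by (simp add: closed_span_subset_iff[OF N])
      then have "cinner (?Q ?v) ?v = 0" by blast
      then have "cinner (?Q ?v) (?Q ?v) = 0"
        using Projs_sym[OF pQ, of "?Q ?v" ?v] by (simp add: Projs_idem[OF pQ])
      then show ?thesis by (simp add: cinner_self_eq_0)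
    qed
    ultimately show ?thesis using intertwines_iff[OF pL pQ bT] by blast
  qed
  then show ?thesis using bT by (simp add: intertwiners_def)
qed

lemma intertwiner_semi_normalizes:
  assumes \<A>: "reflexive_algebra \<A>" and \<B>: "reflexive_algebra \<B>"
    and \<phi>: "\<And>L. L \<in> Lat \<A> \<Longrightarrow> \<phi> L \<in> Lat \<B>"
    and T: "T \<in> intertwiners (Lat \<A>) \<phi>"
  shows "T \<in> SN \<B> \<A>"
proof -
  have bT: "bounded_clinear T" using T by (simp add: intertwiners_def)
  have "cadjoint T \<circ> B \<circ> T \<in> \<A>" if B: "B \<in> \<B>" for B
    unfolding reflexive_algebra_iff[OF \<A>]
  proof (intro conjI ballI allI impI)
    show "bounded_clinear (cadjoint T \<circ> B \<circ> T)"
      by (intro bounded_clinear_comp bounded_clinear_cadjoint bT reflexive_algebra_bounded[OF \<B> B])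
    fix L x assume L: "L \<in> Lat \<A>" and x: "L x = x"
    have tw: "T (L y) = \<phi> L (T y)" for y
      using T L by (auto simp: intertwiners_def fun_eq_iff)
    have "\<phi> L (B (T x)) = B (T x)"
      using \<phi>[OF L] B tw[of x] x by (simp add: Lat_iff)
    moreover have "cadjoint T (\<phi> L y) = L (cadjoint T y)" for y
      using L \<phi>[OF L] bT tw by (intro cadjoint_intertwines) (auto simp: Lat_iff)
    ultimately show "L ((cadjoint T \<circ> B \<circ> T) x) = (cadjoint T \<circ> B \<circ> T) x"
      by (metis comp_apply)
  qed
  then show ?thesis using bT by (simp add: SN_def)
qed

theorem theorem5p2:
  fixes \<A> :: "('a::separable_hilbert \<Rightarrow> 'a) set"
    and \<B> :: "('b::separable_hilbert \<Rightarrow> 'b) set"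
  assumes "reflexive_algebra \<A>" and "reflexive_algebra \<B>"
  shows "(\<exists>\<F>. (\<forall>U\<in>\<F>. reflexive_subspace U \<and> normalizing_subspace U) \<and> SN \<B> \<A> = \<Union>\<F>)
    \<and> SN \<B> \<A> = (\<Union>\<phi>\<in>sup_maps_between (Lat \<A>) (Lat \<B>). intertwiners (Lat \<A>) \<phi>)
    \<and> (\<forall>\<phi>\<in>sup_maps_between (Lat \<A>) (Lat \<B>).
          reflexive_subspace (intertwiners (Lat \<A>) \<phi>) \<and>
          normalizing_subspace (intertwiners (Lat \<A>) \<phi>))"
proof -
  let ?M = "sup_maps_between (Lat \<A>) (Lat \<B>)" and ?I = "intertwiners (Lat \<A>)"
  have sub: "Lat \<A> \<subseteq> Projs" by (auto simp: Lat_iff)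
  have \<phi>: "\<phi> L \<in> Lat \<B>" "\<phi> L \<in> Projs" if "\<phi> \<in> ?M" "L \<in> Lat \<A>" for \<phi> L
    using that sub by (auto simp: sup_maps_between_def S2_def Lat_iff)
  have good: "\<forall>\<phi>\<in>?M. reflexive_subspace (?I \<phi>) \<and> normalizing_subspace (?I \<phi>)"
    using reflexive_intertwiners[OF sub] normalizing_intertwiners[OF sub] \<phi>(2) by blast
  have union: "SN \<B> \<A> = (\<Union>\<phi>\<in>?M. ?I \<phi>)"
  proof (intro set_eqI iffI)
    fix T assume T: "T \<in> SN \<B> \<A>"
    then have "bounded_clinear T" by (simp add: SN_def)
    from sup_map_sandwich_between[OF assms this] semi_normalizer_intertwines[OF assms T]
    show "T \<in> (\<Union>\<phi>\<in>?M. ?I \<phi>)" by blast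
  qed (use intertwiner_semi_normalizes[OF assms] \<phi>(1) in blast)
  have "\<exists>\<F>. (\<forall>U\<in>\<F>. reflexive_subspace U \<and> normalizing_subspace U) \<and> SN \<B> \<A> = \<Union>\<F>"
    using good union by (intro exI[of _ "?I ` ?M"]) auto
  with good union show ?thesis by blast
qed

end
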